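(* Let $\mathcal{G}$ be a branching simple stochastic game (BSSG) with types $T_1,\dots,T_n$ and a designated target type $T_{f^*}$, and let $x=P(x)$ be the associated max-minPPS (defined in the context), with one variable $x_i$ for each type $T_i\neq T_{f^*}$. Then the vector $g^*$ of non-reachability values (where $g^*_i$ is the value for the initial population consisting of a single object of type $T_i$) is the greatest fixed point (GFP) of the operator $P$ in $[0,1]^{n-1}$: that is, $g^*=P(g^* )$, and every fixed point $g'=P(g')$ with $g'\in[0,1]^{n-1}$ satisfies $g'\le g^*$. Furthermore, for every finite initial population $\mu\in\mathbb{N}^n$ with $\mu_{f^*}=0$, the optimal non-reachability values satisfy $g^*(\mu)=\prod_i (g^*_i)^{\mu_i}$ and $$g^*(\mu)=\sup_{\sigma\in\Psi_1}\inf_{\tau\in\Psi_2} g^*_{\sigma,\tau}(\mu)=\inf_{\tau\in\Psi_2}\sup_{\sigma\in\Psi_1} g^*_{\sigma,\tau}(\mu).$$ In particular, such games are determined.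
   Context: A BSSG consists of types $T_1,\dots,T_n$, for each type $T_i$ a finite nonempty set $A_i$ of actions, and for each $a\in A_i$ a finite set $R(T_i,a)$ of rules $T_i\xrightarrow{p_r}\alpha_r$, where $\alpha_r\in\mathbb{N}^n$ is a multiset of types and $p_r\in(0,1]\cap\mathbb{Q}$, with $\sum_{r\in R(T_i,a)}p_r=1$. The types are partitioned between two players: player N (who wants to maximize the probability of never producing an object of the target type $T_{f^*}$) and player R (who wants to minimize it). A play starts from a population $X_0\in\mathbb{N}^n$; given $X_k$, each player chooses, for every object of $X_k$ whose type it owns, an action available for that type; then for each object independently a rule of the chosen action is selected with the rule probabilities, and each object is replaced by the multiset of objects on the right side of its rule, giving $X_{k+1}$. A strategy of a player maps each finite history (the entire labelled forest of past generations, with actions and rules applied and parent–child relations) to a probability distribution over tuples of actions for the objects it owns in the current population; strategies may be history-dependent and randomized. $\Psi_1$ and $\Psi_2$ denote the sets of strategies of players N and R. For strategies $\sigma\in\Psi_1,\tau\in\Psi_2$ and initial population $\mu$ with $\mu_{f^*}=0$, $g^*_{\sigma,\tau}(\mu)$ is the probability that $(X_d)_{f^*}=0$ for all $d\ge0$, and $g^*(\mu):=\sup_{\sigma\in\Psi_1}\inf_{\tau\in\Psi_2}g^*_{\sigma,\tau}(\mu)$; $g^*_i:=g^*(\mu)$ when $\mu$ is a single object of type $T_i$. For $v\in\mathbb{N}^n$, $x^{v}$ denotes $\prod_i x_i^{v_i}$. The associated max-minPPS has for each type $T_i\ne T_{f^*}$ the equation $x_i=P_i(x)$, where for $a\in A_i$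 we set $q_{i,a}(x)=\sum_{r\in R(T_i,a),\,(\alpha_r)_{f^*}=0}p_r x^{\alpha_r}$ (rules producing an object of type $T_{f^*}$ are omitted), and $P_i(x)=\max_{a\in A_i}q_{i,a}(x)$ if $T_i$ belongs to player N, $P_i(x)=\min_{a\in A_i}q_{i,a}(x)$ if $T_i$ belongs to player R. Inequalities between vectors are coordinatewise. *)

theory Defs
  imports "HOL-Probability.Probability" "HOL-Probability.Product_PMF"
begin

section \<open>Branching simple stochastic games\<close>

datatype player = Player_N | Player_R

text \<open>
  Types are the elements of a finite type \<open>'t\<close>, so a vector in \<open>\<nat>\<^sup>n\<close> is a function \<open>'t \<Rightarrow> nat\<close>.
  Rules carry names from \<open>'r\<close>, so that \<open>rules G i a\<close> may contain distinct rules with the same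
  probability and the same right-hand side.
\<close>

record ('t, 'a, 'r) bssg =
  owner :: "'t \<Rightarrow> player"
  actions :: "'t \<Rightarrow> 'a set"
  rules :: "'t \<Rightarrow> 'a \<Rightarrow> 'r set"
  rule_prob :: "'r \<Rightarrow> real"
  rule_rhs :: "'r \<Rightarrow> 't \<Rightarrow> nat"

definition is_bssg :: "('t::finite, 'a, 'r) bssg \<Rightarrow> bool" where
  "is_bssg G \<longleftrightarrow>
     (\<forall>i. finite (actions G i) \<and> actions G i \<noteq> {}) \<and>
     (\<forall>i. \<forall>a\<in>actions G i.
        finite (rules G i a) \<and>
        (\<forall>r\<in>rules G i a. rule_prob G r \<in> {0<..1} \<inter> \<rat>) \<and>
        (\<Sum>r\<in>rules G i a. rule_prob G r) = 1)"

subsection \<open>Objects, populations and histories\<close>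

text \<open>
  An object records its type, its parent (if any), and an index that distinguishes it from its
  siblings of the same type. A population is the set of objects of one generation; since objects
  know their ancestors, the sequence of generations, each with the actions and rules applied to its
  objects, is the labelled forest of the history.
\<close>

datatype 't obj =
    Root (obj_type: 't) nat
  | Child "'t obj" (obj_type: 't) nat

definition initial_population :: "('t \<Rightarrow> nat) \<Rightarrow> 't obj set" where
  "initial_population \<mu> = {Root i k | i k. k < \<mu> i}"

definition type_count :: "'t obj set \<Rightarrow> 't \<Rightarrow> nat" where
  "type_count X i = card {ob\<in>X. obj_type ob = i}"

text \<open>A step maps each object of a generation to the action and the rule applied to it.\<close>

type_synonym ('t, 'a, 'r) step = "'t obj \<rightharpoonup> 'a \<times> 'r"

definition is_step :: "('t, 'a, 'r) bssg \<Rightarrow> 't obj set \<Rightarrow> ('t, 'a, 'r) step \<Rightarrow> bool" where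
  "is_step G X s \<longleftrightarrow> dom s = X \<and>
     (\<forall>ob a r. s ob = Some (a, r) \<longrightarrow>
        a \<in> actions G (obj_type ob) \<and> r \<in> rules G (obj_type ob) a)"

definition next_population :: "('t, 'a, 'r) bssg \<Rightarrow> ('t, 'a, 'r) step \<Rightarrow> 't obj set" where
  "next_population G s =
     {Child ob j k | ob j k. \<exists>a r. s ob = Some (a, r) \<and> k < rule_rhs G r j}"

text \<open>A history is an initial population together with the steps taken so far, oldest first.\<close>

type_synonym ('t, 'a, 'r) history = "('t \<Rightarrow> nat) \<times> ('t, 'a, 'r) step list"

definition population :: "('t, 'a, 'r) bssg \<Rightarrow> ('t, 'a, 'r) history \<Rightarrow> 't obj set" where
  "population G = (\<lambda>(\<mu>, ss).
     if ss = [] then initial_population \<mu> else next_population G (last ss))"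

inductive_set histories :: "('t, 'a, 'r) bssg \<Rightarrow> ('t, 'a, 'r) history set"
  for G :: "('t, 'a, 'r) bssg" where
    "(\<mu>, []) \<in> histories G"
  | "(\<mu>, ss) \<in> histories G \<Longrightarrow> is_step G (population G (\<mu>, ss)) s \<Longrightarrow>
       (\<mu>, ss @ [s]) \<in> histories G"

subsection \<open>Strategies\<close>

definition owned :: "('t, 'a, 'r) bssg \<Rightarrow> player \<Rightarrow> 't obj set \<Rightarrow> 't obj set" where
  "owned G p X = {ob\<in>X. owner G (obj_type ob) = p}"

type_synonym ('t, 'a, 'r) strategy = "('t, 'a, 'r) history \<Rightarrow> ('t obj \<Rightarrow> 'a) pmf"

definition strategies :: "('t, 'a, 'r) bssg \<Rightarrow> player \<Rightarrow> ('t, 'a, 'r) strategy set" where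
  "strategies G p =
     {\<sigma>. \<forall>h\<in>histories G.
        set_pmf (\<sigma> h) \<subseteq> (\<Pi>\<^sub>E ob\<in>owned G p (population G h). actions G (obj_type ob))}"

subsection \<open>The probability space of plays\<close>

definition rule_pmf :: "('t, 'a, 'r) bssg \<Rightarrow> 't \<Rightarrow> 'a \<Rightarrow> 'r pmf" where
  "rule_pmf G i a = embed_pmf (\<lambda>r. if r \<in> rules G i a then rule_prob G r else 0)"

definition step_pmf ::
  "('t, 'a, 'r) bssg \<Rightarrow> ('t, 'a, 'r) strategy \<Rightarrow> ('t, 'a, 'r) strategy \<Rightarrow>
     ('t, 'a, 'r) history \<Rightarrow> ('t, 'a, 'r) step pmf" where
  "step_pmf G \<sigma> \<tau> h =
     bind_pmf (\<sigma> h) (\<lambda>u. bind_pmf (\<tau> h) (\<lambda>w.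
       let act = (\<lambda>ob. if owner G (obj_type ob) = Player_N then u ob else w ob)
       in Pi_pmf (population G h) None
            (\<lambda>ob. map_pmf (\<lambda>r. Some (act ob, r)) (rule_pmf G (obj_type ob) (act ob)))))"

definition extend_history :: "('t, 'a, 'r) history \<Rightarrow> ('t, 'a, 'r) step \<Rightarrow> ('t, 'a, 'r) history" where
  "extend_history = (\<lambda>(\<mu>, ss) s. (\<mu>, ss @ [s]))"

text \<open>
  A play is the sequence of its finite histories: coordinate \<open>d\<close> is the history up to
  generation \<open>d\<close>. For each \<open>d\<close>, \<open>play_kernel\<close> gives the distribution of coordinate \<open>d\<close> as a function
  of the earlier coordinates, and \<open>play_measure\<close> is the measure that the Ionescu-Tulcea theorem
  assigns to these kernels.
\<close>

definition play_kernel ::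
  "('t, 'a, 'r) bssg \<Rightarrow> ('t, 'a, 'r) strategy \<Rightarrow> ('t, 'a, 'r) strategy \<Rightarrow> ('t \<Rightarrow> nat) \<Rightarrow>
     nat \<Rightarrow> (nat \<Rightarrow> ('t, 'a, 'r) history) \<Rightarrow> ('t, 'a, 'r) history measure" where
  "play_kernel G \<sigma> \<tau> \<mu> d \<omega> =
     measure_pmf
       (case d of
          0 \<Rightarrow> return_pmf (\<mu>, [])
        | Suc k \<Rightarrow> map_pmf (extend_history (\<omega> k)) (step_pmf G \<sigma> \<tau> (\<omega> k)))"

lemma Ionescu_Tulcea_play_kernel:
  "Ionescu_Tulcea (play_kernel G \<sigma> \<tau> \<mu>) (\<lambda>_. count_space UNIV)"
proof (rule Ionescu_Tulcea.intro)
  fix d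
  show "play_kernel G \<sigma> \<tau> \<mu> d \<in>
    PiM {0..<d} (\<lambda>_. count_space UNIV) \<rightarrow>\<^sub>M subprob_algebra (count_space UNIV)"
  proof (cases d)
    case 0
    then have "play_kernel G \<sigma> \<tau> \<mu> d = (\<lambda>_. measure_pmf (return_pmf (\<mu>, [])))"
      by (simp add: fun_eq_iff play_kernel_def)
    then show ?thesis
      by (simp only:) (rule measurable_const, rule measure_pmf_in_subprob_algebra)
  next
    case (Suc k)
    have "(\<lambda>\<omega>. \<omega> k) \<in> PiM {0..<d} (\<lambda>_. count_space UNIV) \<rightarrow>\<^sub>M count_space UNIV"
      using Suc by (intro measurable_component_singleton) auto
    moreover have "(\<lambda>h. measure_pmf (map_pmf (extend_history h) (step_pmf G \<sigma> \<tau> h)))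
        \<in> count_space UNIV \<rightarrow>\<^sub>M subprob_algebra (count_space UNIV)"
      by (simp add: measure_pmf_in_subprob_algebra)
    ultimately have "(\<lambda>\<omega>. measure_pmf (map_pmf (extend_history (\<omega> k)) (step_pmf G \<sigma> \<tau> (\<omega> k))))
        \<in> PiM {0..<d} (\<lambda>_. count_space UNIV) \<rightarrow>\<^sub>M subprob_algebra (count_space UNIV)"
      by (rule measurable_compose)
    moreover have "play_kernel G \<sigma> \<tau> \<mu> d =
        (\<lambda>\<omega>. measure_pmf (map_pmf (extend_history (\<omega> k)) (step_pmf G \<sigma> \<tau> (\<omega> k))))"
      using Suc by (simp add: fun_eq_iff play_kernel_def)
    ultimately show ?thesis
      by simp
  qed
  fix \<omega>
  show "prob_space (play_kernel G \<sigma> \<tau> \<mu> d \<omega>)"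
    by (simp add: play_kernel_def prob_space_measure_pmf)
qed

definition play_measure ::
  "('t, 'a, 'r) bssg \<Rightarrow> ('t, 'a, 'r) strategy \<Rightarrow> ('t, 'a, 'r) strategy \<Rightarrow> ('t \<Rightarrow> nat) \<Rightarrow>
     (nat \<Rightarrow> ('t, 'a, 'r) history) measure" where
  "play_measure G \<sigma> \<tau> \<mu> =
     projective_family.lim UNIV
       (Ionescu_Tulcea.CI (play_kernel G \<sigma> \<tau> \<mu>) (\<lambda>_. count_space UNIV))
       (\<lambda>_. count_space UNIV)"

subsection \<open>Non-reachability values\<close>

definition nonreach_prob ::
  "('t, 'a, 'r) bssg \<Rightarrow> 't \<Rightarrow> ('t, 'a, 'r) strategy \<Rightarrow> ('t, 'a, 'r) strategy \<Rightarrow>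
     ('t \<Rightarrow> nat) \<Rightarrow> real" where
  "nonreach_prob G f \<sigma> \<tau> \<mu> =
     measure (play_measure G \<sigma> \<tau> \<mu>)
       {\<omega> \<in> space (play_measure G \<sigma> \<tau> \<mu>). \<forall>d. type_count (population G (\<omega> d)) f = 0}"

definition nonreach_value :: "('t, 'a, 'r) bssg \<Rightarrow> 't \<Rightarrow> ('t \<Rightarrow> nat) \<Rightarrow> real" where
  "nonreach_value G f \<mu> =
     (SUP \<sigma>\<in>strategies G Player_N. INF \<tau>\<in>strategies G Player_R. nonreach_prob G f \<sigma> \<tau> \<mu>)"

definition single_object :: "'t \<Rightarrow> 't \<Rightarrow> nat" where
  "single_object i = (\<lambda>_. 0)(i := 1)"

text \<open>
  Vectors with one coordinate for each type other than the target \<open>f\<close> are extensional functions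
  on \<open>- {f}\<close>.
\<close>

definition nonreach_vector :: "('t, 'a, 'r) bssg \<Rightarrow> 't \<Rightarrow> 't \<Rightarrow> real" where
  "nonreach_vector G f = (\<lambda>i\<in>- {f}. nonreach_value G f (single_object i))"

subsection \<open>The associated max-min probabilistic polynomial system\<close>

text \<open>
  Wherever \<open>vec_power\<close> is applied to vectors indexed by \<open>- {f}\<close>, the exponent of coordinate \<open>f\<close>
  is \<open>0\<close>, so the factor at \<open>f\<close> is \<open>1\<close>.
\<close>

definition vec_power :: "('t::finite \<Rightarrow> real) \<Rightarrow> ('t \<Rightarrow> nat) \<Rightarrow> real" where
  "vec_power x v = (\<Prod>i\<in>UNIV. x i ^ v i)"

definition action_poly ::
  "('t::finite, 'a, 'r) bssg \<Rightarrow> 't \<Rightarrow> 't \<Rightarrow> 'a \<Rightarrow> ('t \<Rightarrow> real) \<Rightarrow> real" where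
  "action_poly G f i a x =
     (\<Sum>r | r \<in> rules G i a \<and> rule_rhs G r f = 0. rule_prob G r * vec_power x (rule_rhs G r))"

definition maxmin_op ::
  "('t::finite, 'a, 'r) bssg \<Rightarrow> 't \<Rightarrow> ('t \<Rightarrow> real) \<Rightarrow> 't \<Rightarrow> real" where
  "maxmin_op G f x =
     (\<lambda>i\<in>- {f}. case owner G i of
        Player_N \<Rightarrow> MAX a\<in>actions G i. action_poly G f i a x
      | Player_R \<Rightarrow> MIN a\<in>actions G i. action_poly G f i a x)"

end

theory Submission
  imports Defs
begin

text \<open>
  Let \<open>x\<^sup>0 = 1\<close> and \<open>x\<^sup>k\<^sup>+\<^sup>1 = P(x\<^sup>k)\<close>. These vectors decrease to a fixed point \<open>g\<close> by continuity of
  \<open>P\<close>, and they dominate every fixed point by monotonicity. For a vector \<open>x\<close> give a population \<open>X\<close> the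
  potential \<open>x\<^sup>X\<close>, read as \<open>0\<close> if \<open>X\<close> contains a target object. Since the rules of distinct objects
  are drawn independently, its expectation after one step is a product of the polynomials \<open>q\<^sub>i\<^sub>,\<^sub>a(x)\<close>.
  If player N always picks actions that are optimal for \<open>g\<close>, the potential of \<open>g\<close> is therefore a
  submartingale, so the target is avoided with probability at least \<open>g\<^sup>\<mu>\<close>. If player R picks, in
  generation \<open>d < k\<close>, actions that are optimal for the vector with index \<open>k - d - 1\<close>, the potential of
  the vector with index \<open>k - d\<close> is a supermartingale, so the target is avoided for \<open>k\<close> generations
  with probability at most the value of \<open>x\<^sup>k\<close> at \<open>\<mu>\<close>, which tends to \<open>g\<^sup>\<mu>\<close>. Thus \<open>g\<^sup>\<mu>\<close> is both the
  sup-inf and the inf-sup.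
\<close>

subsection \<open>Integrals over plays\<close>

lemma (in Ionescu_Tulcea) nn_integral_lim_restrict:
  assumes [measurable]: "g \<in> borel_measurable (PiM {0..<n} M)"
  shows "(\<integral>\<^sup>+\<omega>. g (restrict \<omega> {0..<n}) \<partial>PF.lim) = (\<integral>\<^sup>+\<omega>. g \<omega> \<partial>C 0 n (\<lambda>_. undefined))"
proof -
  have le: "up_to {0..<n} \<le> n"
    by (simp add: up_to_iff)
  have upper: "n \<le> up_to {0..<n}"
    using up_to[of "{0..<n}"] by (cases "n = 0") auto
  have CI: "CI {0..<n} = C 0 n (\<lambda>_. undefined)"
    using distr_C[of n n "\<lambda>_. undefined" 0] le upper by (simp add: CI_def)
  have "(\<integral>\<^sup>+\<omega>. g \<omega> \<partial>distr PF.lim (PiM {0..<n} M) (\<lambda>\<omega>. restrict \<omega> {0..<n})) =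
      (\<integral>\<^sup>+\<omega>. g (restrict \<omega> {0..<n}) \<partial>PF.lim)"
    by (rule nn_integral_distr)
       (simp_all add: measurable_cong_sets[OF PF.sets_lim refl] measurable_restrict_subset)
  then show ?thesis
    by (simp add: distr_lim CI)
qed

lemma (in Ionescu_Tulcea) nn_integral_lim_Suc:
  assumes [measurable]: "g \<in> borel_measurable (PiM {0..<Suc n} M)"
  shows "(\<integral>\<^sup>+\<omega>. g (restrict \<omega> {0..<Suc n}) \<partial>PF.lim) =
    (\<integral>\<^sup>+\<omega>. (\<integral>\<^sup>+x. g ((restrict \<omega> {0..<n})(n := x)) \<partial>P n (restrict \<omega> {0..<n})) \<partial>PF.lim)"
proof -
  have meas: "(\<lambda>\<omega>. \<integral>\<^sup>+x. g x \<partial>eP n \<omega>) \<in> borel_measurable (PiM {0..<n} M)"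
    by measurable
  have "(\<integral>\<^sup>+\<omega>. g (restrict \<omega> {0..<Suc n}) \<partial>PF.lim) = (\<integral>\<^sup>+\<omega>. g \<omega> \<partial>C 0 (Suc n) (\<lambda>_. undefined))"
    by (rule nn_integral_lim_restrict) simp
  also have "\<dots> = (\<integral>\<^sup>+\<omega>. (\<integral>\<^sup>+x. g x \<partial>eP n \<omega>) \<partial>C 0 n (\<lambda>_. undefined))"
    by (simp, subst nn_integral_bind[where B = "PiM {0..<Suc n} M"])
       (simp_all add: measurable_cong_sets[OF sets_C refl])
  also have "\<dots> = (\<integral>\<^sup>+\<omega>. (\<integral>\<^sup>+x. g x \<partial>eP n (restrict \<omega> {0..<n})) \<partial>PF.lim)"
    by (rule nn_integral_lim_restrict[symmetric]) (rule meas)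
  also have "\<dots> = (\<integral>\<^sup>+\<omega>. (\<integral>\<^sup>+x. g ((restrict \<omega> {0..<n})(n := x)) \<partial>P n (restrict \<omega> {0..<n})) \<partial>PF.lim)"
    by (intro nn_integral_cong nn_integral_eP) (auto simp: space_PiM PiE_iff)
  finally show ?thesis .
qed

lemma (in Ionescu_Tulcea) prob_space_lim: "prob_space PF.lim"
proof
  have "emeasure PF.lim (space PF.lim) = (\<integral>\<^sup>+\<omega>. 1 \<partial>PF.lim)"
    by simp
  also have "\<dots> = (\<integral>\<^sup>+\<omega>. 1 \<partial>C 0 0 (\<lambda>_. undefined))"
    using nn_integral_lim_restrict[of "\<lambda>_. 1" 0] by simp
  also have "\<dots> = 1"
    using prob_space.emeasure_space_1[OF prob_space_C[of "\<lambda>_. undefined" 0 0]]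
    by (simp only: nn_integral_const mult_1_left) (simp add: space_PiM)
  finally show "emeasure PF.lim (space PF.lim) = 1" .
qed

definition survival ::
  "('t, 'a, 'r) history set \<Rightarrow> nat \<Rightarrow> (nat \<Rightarrow> ('t, 'a, 'r) history) set" where
  "survival K d = {\<omega>. \<forall>j\<le>d. \<omega> j \<in> K}"

lemma sets_play_measure [measurable_cong]:
  "sets (play_measure G \<sigma> \<tau> \<mu>) = sets (PiM UNIV (\<lambda>_. count_space UNIV))"
  and space_play_measure [simp]: "space (play_measure G \<sigma> \<tau> \<mu>) = UNIV"
proof -
  interpret Ionescu_Tulcea "play_kernel G \<sigma> \<tau> \<mu>" "\<lambda>_. count_space UNIV"
    by (rule Ionescu_Tulcea_play_kernel)
  show "sets (play_measure G \<sigma> \<tau> \<mu>) = sets (PiM UNIV (\<lambda>_. count_space UNIV))"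
    "space (play_measure G \<sigma> \<tau> \<mu>) = UNIV"
    by (simp_all add: play_measure_def space_PiM)
qed

lemma prob_space_play_measure: "prob_space (play_measure G \<sigma> \<tau> \<mu>)"
  unfolding play_measure_def
  by (rule Ionescu_Tulcea.prob_space_lim[OF Ionescu_Tulcea_play_kernel])

lemma measurable_play_coordinate [measurable]:
  "(\<lambda>\<omega>. \<omega> d) \<in> play_measure G \<sigma> \<tau> \<mu> \<rightarrow>\<^sub>M count_space UNIV"
  by (simp add: measurable_cong_sets[OF sets_play_measure refl])

lemma sets_survival [measurable]: "survival K d \<in> sets (play_measure G \<sigma> \<tau> \<mu>)"
proof -
  have "(\<lambda>\<omega>. \<omega> j) -` K \<inter> space (play_measure G \<sigma> \<tau> \<mu>) \<in> sets (play_measure G \<sigma> \<tau> \<mu>)" for j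
    by (rule measurable_sets[OF measurable_play_coordinate]) simp
  moreover have "survival K d = (\<Inter>j\<le>d. (\<lambda>\<omega>. \<omega> j) -` K \<inter> space (play_measure G \<sigma> \<tau> \<mu>))"
    by (auto simp: survival_def)
  ultimately show ?thesis
    by (simp only:) (intro sets.finite_INT, auto)
qed

lemma nn_integral_play_0:
  "(\<integral>\<^sup>+\<omega>. indicator (survival K 0) \<omega> * \<phi> (\<omega> 0) \<partial>play_measure G \<sigma> \<tau> \<mu>) =
     indicator K (\<mu>, []) * \<phi> (\<mu>, [])"
proof -
  interpret Ionescu_Tulcea "play_kernel G \<sigma> \<tau> \<mu>" "\<lambda>_. count_space UNIV"
    by (rule Ionescu_Tulcea_play_kernel)
  interpret lim: prob_space PF.lim
    by (rule prob_space_lim)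
  let ?g = "\<lambda>\<omega>. indicator K (\<omega> 0) * \<phi> (\<omega> 0)"
  have "(\<lambda>\<omega>. \<omega> 0) \<in> PiM {0..<Suc 0} (\<lambda>_. count_space UNIV) \<rightarrow>\<^sub>M count_space UNIV"
    by (rule measurable_component_singleton) simp
  then have "?g \<in> borel_measurable (PiM {0..<Suc 0} (\<lambda>_. count_space UNIV))"
    by (rule measurable_compose) simp
  from nn_integral_lim_Suc[OF this] show ?thesis
    by (simp add: play_measure_def play_kernel_def survival_def indicator_def
        lim.emeasure_space_1[simplified])
qed

lemma nn_integral_play_Suc:
  "(\<integral>\<^sup>+\<omega>. indicator (survival K (Suc d)) \<omega> * \<phi> (\<omega> (Suc d)) \<partial>play_measure G \<sigma> \<tau> \<mu>) =
   (\<integral>\<^sup>+\<omega>. indicator (survival K d) \<omega> *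
      (\<integral>\<^sup>+s. indicator K (extend_history (\<omega> d) s) * \<phi> (extend_history (\<omega> d) s)
         \<partial>step_pmf G \<sigma> \<tau> (\<omega> d)) \<partial>play_measure G \<sigma> \<tau> \<mu>)"
proof -
  interpret Ionescu_Tulcea "play_kernel G \<sigma> \<tau> \<mu>" "\<lambda>_. count_space UNIV"
    by (rule Ionescu_Tulcea_play_kernel)
  let ?g = "\<lambda>\<omega>. (\<Prod>j\<le>Suc d. indicator K (\<omega> j)) * \<phi> (\<omega> (Suc d))"
  have surv: "indicator (survival K n) \<omega> = (\<Prod>j\<le>n. indicator K (\<omega> j) :: ennreal)" for n \<omega>
    by (auto simp: survival_def indicator_def prod_zero_iff)
  have coord: "(\<lambda>\<omega>. \<omega> j) \<in> PiM {0..<Suc (Suc d)} (\<lambda>_. count_space UNIV) \<rightarrow>\<^sub>M count_space UNIV"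
    if "j \<le> Suc d" for j
    using that by (intro measurable_component_singleton) simp
  have "?g \<in> borel_measurable (PiM {0..<Suc (Suc d)} (\<lambda>_. count_space UNIV))"
    by (intro borel_measurable_times_ennreal borel_measurable_prod_ennreal
        measurable_compose[OF coord]) auto
  from nn_integral_lim_Suc[OF this] show ?thesis
    unfolding surv
    by (simp add: play_measure_def play_kernel_def mult.assoc nn_integral_cmult)
qed


subsection \<open>Populations and potentials\<close>

lemma finite_initial_population:
  fixes \<mu> :: "'t::finite \<Rightarrow> nat"
  shows "finite (initial_population \<mu>)"
proof -
  have "initial_population \<mu> = (\<lambda>(i, k). Root i k) ` (SIGMA i:UNIV. {..<\<mu> i})"
    by (auto simp: initial_population_def)
  then show ?thesis
    by simp
qed

lemma next_population_eq_image:
  "next_population G s =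
     (\<lambda>(ob, j, k). Child ob j k) ` (SIGMA ob:dom s. SIGMA j:UNIV. {..<rule_rhs G (snd (the (s ob))) j})"
  by (force simp: next_population_def)

lemma finite_next_population:
  fixes G :: "('t::finite, 'a, 'r) bssg"
  assumes "finite (dom s)"
  shows "finite (next_population G s)"
  using assms by (simp add: next_population_eq_image finite_SigmaI)

lemma population_extend_history: "population G (extend_history h s) = next_population G s"
  by (simp add: population_def extend_history_def split: prod.split)

lemma finite_population:
  fixes G :: "('t::finite, 'a, 'r) bssg"
  assumes "h \<in> histories G"
  shows "finite (population G h)"
proof -
  obtain \<mu> ss where "h = (\<mu>, ss)"
    by (cases h)
  with assms have "(\<mu>, ss) \<in> histories G"
    by simp
  then have "finite (population G (\<mu>, ss))"
  proof (induction rule: histories.induct)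
    case (1 \<mu>)
    then show ?case
      by (simp add: population_def finite_initial_population)
  next
    case (2 \<mu> ss s)
    then have "finite (dom s)"
      by (simp add: is_step_def)
    then show ?case
      by (simp add: population_def finite_next_population)
  qed
  with \<open>h = (\<mu>, ss)\<close> show ?thesis
    by simp
qed

lemma prod_obj_type_eq_vec_power:
  assumes "finite X"
  shows "(\<Prod>ob\<in>X. y (obj_type ob)) = vec_power y (type_count X)"
proof -
  have "(\<Prod>ob\<in>X. y (obj_type ob)) = (\<Prod>i\<in>UNIV. \<Prod>ob\<in>{ob\<in>X. obj_type ob = i}. y (obj_type ob))"
    using assms by (intro prod.group[symmetric]) auto
  also have "\<dots> = vec_power y (type_count X)"
    unfolding vec_power_def type_count_def by (intro prod.cong) auto
  finally show ?thesis .
qed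

lemma prod_next_population:
  fixes G :: "('t::finite, 'a, 'r) bssg"
  assumes "finite (dom s)"
  shows "(\<Prod>ob\<in>next_population G s. y (obj_type ob)) =
    (\<Prod>ob\<in>dom s. vec_power y (rule_rhs G (snd (the (s ob)))))"
proof -
  let ?S = "SIGMA ob:dom s. SIGMA j:UNIV. {..<rule_rhs G (snd (the (s ob))) j}"
  have inj: "inj_on (\<lambda>(ob, j, k). Child ob j k) ?S"
    by (auto simp: inj_on_def)
  have "(\<Prod>ob\<in>next_population G s. y (obj_type ob)) = (\<Prod>(ob, j, k)\<in>?S. y j)"
    unfolding next_population_eq_image prod.reindex[OF inj] by (intro prod.cong) auto
  also have "\<dots> = (\<Prod>ob\<in>dom s. \<Prod>(j, k)\<in>(SIGMA j:UNIV. {..<rule_rhs G (snd (the (s ob))) j}). y j)"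
    by (rule prod.Sigma[symmetric]) (use assms in auto)
  also have "\<dots> = (\<Prod>ob\<in>dom s. \<Prod>j\<in>UNIV. \<Prod>k<rule_rhs G (snd (the (s ob))) j. y j)"
    by (intro prod.cong refl prod.Sigma[symmetric]) auto
  also have "\<dots> = (\<Prod>ob\<in>dom s. vec_power y (rule_rhs G (snd (the (s ob)))))"
    by (simp add: vec_power_def)
  finally show ?thesis .
qed

lemma vec_power_fun_upd_0:
  fixes x :: "'t::finite \<Rightarrow> real"
  shows "vec_power (x(f := 0)) v = (if v f = 0 then vec_power x v else 0)"
proof (cases "v f = 0")
  case True
  then have "(x(f := 0)) i ^ v i = x i ^ v i" for i
    by simp
  with True show ?thesis
    by (simp add: vec_power_def)
next
  case False
  then show ?thesis
    by (auto simp: vec_power_def prod_zero_iff intro!: exI[of _ f])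
qed

lemma vec_power_nonneg:
  assumes "\<And>i. v i \<noteq> 0 \<Longrightarrow> 0 \<le> x i"
  shows "0 \<le> vec_power x v"
proof -
  have "0 \<le> x i ^ v i" for i
    using assms[of i] by (cases "v i = 0") simp_all
  then show ?thesis
    unfolding vec_power_def by (intro prod_nonneg) simp
qed

lemma vec_power_mono:
  assumes "\<And>i. v i \<noteq> 0 \<Longrightarrow> 0 \<le> x i \<and> x i \<le> y i"
  shows "vec_power x v \<le> vec_power y v"
proof -
  have "0 \<le> x i ^ v i \<and> x i ^ v i \<le> y i ^ v i" for i
    using assms[of i] by (cases "v i = 0") (simp_all add: power_mono)
  then show ?thesis
    unfolding vec_power_def by (intro prod_mono) simp
qed

definition target_free :: "('t, 'a, 'r) bssg \<Rightarrow> 't \<Rightarrow> ('t, 'a, 'r) history set" where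
  "target_free G f = {h. type_count (population G h) f = 0}"

text \<open>
  Setting coordinate \<open>f\<close> to \<open>0\<close> makes the potential vanish on populations with a target object,
  which matches the omission of target-producing rules in the polynomials.
\<close>

definition potential ::
  "('t, 'a, 'r) bssg \<Rightarrow> 't \<Rightarrow> ('t \<Rightarrow> real) \<Rightarrow> ('t, 'a, 'r) history \<Rightarrow> ennreal" where
  "potential G f x h = (\<Prod>ob\<in>population G h. ennreal ((x(f := 0)) (obj_type ob)))"

definition markov_strategy ::
  "('t, 'a, 'r) bssg \<Rightarrow> player \<Rightarrow> (nat \<Rightarrow> 't \<Rightarrow> 'a) \<Rightarrow> ('t, 'a, 'r) strategy" where
  "markov_strategy G p c h =
     return_pmf (\<lambda>ob\<in>owned G p (population G h). c (length (snd h)) (obj_type ob))"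

definition value_iteration :: "('t::finite, 'a, 'r) bssg \<Rightarrow> 't \<Rightarrow> nat \<Rightarrow> 't \<Rightarrow> real" where
  "value_iteration G f k = (maxmin_op G f ^^ k) (\<lambda>i\<in>- {f}. 1)"

lemma markov_strategy_in_strategies:
  assumes "\<And>d i. c d i \<in> actions G i"
  shows "markov_strategy G p c \<in> strategies G p"
  using assms by (auto simp: strategies_def markov_strategy_def)

lemma type_count_initial_population: "type_count (initial_population \<mu>) = \<mu>"
proof
  fix i
  have "{ob \<in> initial_population \<mu>. obj_type ob = i} = Root i ` {..<\<mu> i}"
    by (auto simp: initial_population_def)
  then show "type_count (initial_population \<mu>) i = \<mu> i"
    by (simp add: type_count_def card_image inj_on_def)
qed

lemma obj_type_target_free:
  assumes "finite (population G h)" "h \<in> target_free G f" "ob \<in> population G h"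
  shows "obj_type ob \<noteq> f"
  using assms by (auto simp: target_free_def type_count_def)

lemma potential_not_target_free:
  assumes "finite (population G h)" "h \<notin> target_free G f"
  shows "potential G f x h = 0"
proof -
  have "{ob \<in> population G h. obj_type ob = f} \<noteq> {}"
    using assms by (auto simp: target_free_def type_count_def card_eq_0_iff)
  then show ?thesis
    using assms by (auto simp: potential_def)
qed

lemma potential_initial:
  fixes x :: "'t::finite \<Rightarrow> real"
  assumes "\<And>i. i \<noteq> f \<Longrightarrow> 0 \<le> x i" "\<mu> f = 0"
  shows "potential G f x (\<mu>, []) = ennreal (vec_power x \<mu>)"
proof -
  have "potential G f x (\<mu>, []) = ennreal (\<Prod>ob\<in>initial_population \<mu>. (x(f := 0)) (obj_type ob))"
    unfolding potential_def population_def using assms by (simp, intro prod_ennreal) auto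
  also have "\<dots> = ennreal (vec_power x \<mu>)"
    using assms(2)
    by (subst prod_obj_type_eq_vec_power)
       (simp_all only: finite_initial_population type_count_initial_population vec_power_fun_upd_0 simp_thms if_True)
  finally show ?thesis .
qed

lemma tendsto_Max_image:
  fixes g :: "'b \<Rightarrow> 'c \<Rightarrow> 'd::linorder_topology"
  assumes "finite A" "A \<noteq> {}" "\<And>a. a \<in> A \<Longrightarrow> (g a \<longlongrightarrow> l a) F"
  shows "((\<lambda>x. MAX a\<in>A. g a x) \<longlongrightarrow> (MAX a\<in>A. l a)) F"
  using assms
proof (induction rule: finite_ne_induct)
  case (insert a A)
  then show ?case
    by (auto simp: Max_insert intro!: tendsto_max)
qed simp

lemma tendsto_Min_image:
  fixes g :: "'b \<Rightarrow> 'c \<Rightarrow> 'd::linorder_topology"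
  assumes "finite A" "A \<noteq> {}" "\<And>a. a \<in> A \<Longrightarrow> (g a \<longlongrightarrow> l a) F"
  shows "((\<lambda>x. MIN a\<in>A. g a x) \<longlongrightarrow> (MIN a\<in>A. l a)) F"
  using assms
proof (induction rule: finite_ne_induct)
  case (insert a A)
  then show ?case
    by (auto simp: Min_insert intro!: tendsto_min)
qed simp

lemma tendsto_vec_power:
  assumes "\<And>i. v i \<noteq> 0 \<Longrightarrow> ((\<lambda>k. X k i) \<longlongrightarrow> x i) F"
  shows "((\<lambda>k. vec_power (X k) v) \<longlongrightarrow> vec_power x v) F"
proof -
  have "((\<lambda>k. X k i ^ v i) \<longlongrightarrow> x i ^ v i) F" for i
    using assms[of i] by (cases "v i = 0") (auto intro: tendsto_power)
  then show ?thesis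
    unfolding vec_power_def by (intro tendsto_prod)
qed

lemma tendsto_action_poly:
  assumes "\<And>i. i \<noteq> f \<Longrightarrow> ((\<lambda>k. X k i) \<longlongrightarrow> x i) F"
  shows "((\<lambda>k. action_poly G f i a (X k)) \<longlongrightarrow> action_poly G f i a x) F"
  unfolding action_poly_def
  by (intro tendsto_sum tendsto_mult tendsto_const tendsto_vec_power assms) auto

lemma extend_history_in_histories:
  assumes "h \<in> histories G" "is_step G (population G h) s"
  shows "extend_history h s \<in> histories G"
  using assms by (cases h) (simp add: extend_history_def histories.intros(2))

lemma length_extend_history: "length (snd (extend_history h s)) = Suc (length (snd h))"
  by (simp add: extend_history_def split: prod.split)

lemma prod_ennreal_mono:
  assumes "\<And>a. a \<in> A \<Longrightarrow> 0 \<le> g a \<and> g a \<le> h a"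
  shows "(\<Prod>a\<in>A. ennreal (g a)) \<le> (\<Prod>a\<in>A. ennreal (h a))"
proof -
  have "(\<Prod>a\<in>A. ennreal (g a)) = ennreal (\<Prod>a\<in>A. g a)"
    using assms by (intro prod_ennreal) auto
  also have "\<dots> \<le> ennreal (\<Prod>a\<in>A. h a)"
    using assms by (intro ennreal_leI prod_mono)
  also have "\<dots> = (\<Prod>a\<in>A. ennreal (h a))"
    using assms by (intro prod_ennreal[symmetric]) (meson order_trans)
  finally show ?thesis .
qed

lemma emeasure_survival:
  "emeasure (play_measure G \<sigma> \<tau> \<mu>) (survival K d) =
     (\<integral>\<^sup>+\<omega>. indicator (survival K d) \<omega> * 1 \<partial>play_measure G \<sigma> \<tau> \<mu>)"
  by simp

lemma nonreach_prob_eq: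
  "nonreach_prob G f \<sigma> \<tau> \<mu> = measure (play_measure G \<sigma> \<tau> \<mu>) (\<Inter>d. survival (target_free G f) d)"
proof -
  have "{\<omega> \<in> space (play_measure G \<sigma> \<tau> \<mu>). \<forall>d. type_count (population G (\<omega> d)) f = 0} =
      (\<Inter>d. survival (target_free G f) d)"
    by (auto simp: survival_def target_free_def)
  then show ?thesis
    by (simp add: nonreach_prob_def)
qed

lemma nonreach_prob_bounds: "nonreach_prob G f \<sigma> \<tau> \<mu> \<in> {0..1}"
  using prob_space.prob_le_1[OF prob_space_play_measure] by (simp add: nonreach_prob_def)

lemma nonreach_prob_ge:
  assumes "\<And>d. ennreal c \<le> emeasure (play_measure G \<sigma> \<tau> \<mu>) (survival (target_free G f) d)"
  shows "c \<le> nonreach_prob G f \<sigma> \<tau> \<mu>"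
proof -
  interpret prob_space "play_measure G \<sigma> \<tau> \<mu>"
    by (rule prob_space_play_measure)
  have "decseq (\<lambda>d. survival (target_free G f) d)"
    by (auto simp: survival_def decseq_def)
  then have "(\<lambda>d. prob (survival (target_free G f) d)) \<longlonglongrightarrow> nonreach_prob G f \<sigma> \<tau> \<mu>"
    unfolding nonreach_prob_eq by (intro finite_Lim_measure_decseq) auto
  moreover have "c \<le> prob (survival (target_free G f) d)" for d
    using assms[of d] by (simp add: emeasure_eq_measure)
  ultimately show ?thesis
    by (intro LIMSEQ_le_const) auto
qed

lemma nonreach_prob_le:
  assumes "emeasure (play_measure G \<sigma> \<tau> \<mu>) (survival (target_free G f) d) \<le> ennreal c" "0 \<le> c"
  shows "nonreach_prob G f \<sigma> \<tau> \<mu> \<le> c"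
proof -
  interpret prob_space "play_measure G \<sigma> \<tau> \<mu>"
    by (rule prob_space_play_measure)
  have "nonreach_prob G f \<sigma> \<tau> \<mu> \<le> prob (survival (target_free G f) d)"
    unfolding nonreach_prob_eq by (intro finite_measure_mono) auto
  also have "\<dots> \<le> c"
    using assms by (simp add: emeasure_eq_measure)
  finally show ?thesis .
qed

lemma value_iteration_0: "i \<noteq> f \<Longrightarrow> value_iteration G f 0 i = 1"
  and value_iteration_Suc: "value_iteration G f (Suc k) = maxmin_op G f (value_iteration G f k)"
  by (simp_all add: value_iteration_def)

subsection \<open>Guarantees of the two players\<close>

context
  fixes G :: "('t::finite, 'a, 'r) bssg" and f :: 't
  assumes bssg: "is_bssg G"
begin

lemma finite_actions: "finite (actions G i)"
  and actions_nonempty: "actions G i \<noteq> {}"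
  using bssg by (auto simp: is_bssg_def)

lemma finite_rules: "a \<in> actions G i \<Longrightarrow> finite (rules G i a)"
  and rule_prob_pos: "a \<in> actions G i \<Longrightarrow> r \<in> rules G i a \<Longrightarrow> 0 < rule_prob G r"
  and sum_rule_prob: "a \<in> actions G i \<Longrightarrow> (\<Sum>r\<in>rules G i a. rule_prob G r) = 1"
  using bssg by (auto simp: is_bssg_def)

lemma pmf_rule_pmf:
  assumes "a \<in> actions G i"
  shows "pmf (rule_pmf G i a) r = (if r \<in> rules G i a then rule_prob G r else 0)"
  unfolding rule_pmf_def
proof (rule pmf_embed_pmf)
  show "0 \<le> (if r \<in> rules G i a then rule_prob G r else 0)" for r
    using rule_prob_pos[OF assms, of r] by auto
  have "(\<integral>\<^sup>+r. ennreal (if r \<in> rules G i a then rule_prob G r else 0) \<partial>count_space UNIV) =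
      (\<Sum>r\<in>rules G i a. ennreal (rule_prob G r))"
    using finite_rules[OF assms]
    by (subst nn_integral_count_space'[where A = "rules G i a"]) auto
  also have "\<dots> = 1"
    using sum_rule_prob[OF assms] rule_prob_pos[OF assms] by (subst sum_ennreal) (auto intro: less_imp_le)
  finally show "(\<integral>\<^sup>+r. ennreal (if r \<in> rules G i a then rule_prob G r else 0) \<partial>count_space UNIV) = 1" .
qed

lemma set_rule_pmf: "a \<in> actions G i \<Longrightarrow> set_pmf (rule_pmf G i a) = rules G i a"
  using rule_prob_pos[of a i] by (force simp: set_pmf_eq pmf_rule_pmf)

lemma nn_integral_rule_pmf:
  assumes a: "a \<in> actions G i" and x: "\<And>j. j \<noteq> f \<Longrightarrow> 0 \<le> x j"
  shows "(\<integral>\<^sup>+r. ennreal (vec_power (x(f := 0)) (rule_rhs G r)) \<partial>rule_pmf G i a) =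
    ennreal (action_poly G f i a x)"
proof -
  have nonneg: "0 \<le> vec_power (x(f := 0)) v" for v
    using x by (intro vec_power_nonneg) auto
  have "(\<integral>\<^sup>+r. ennreal (vec_power (x(f := 0)) (rule_rhs G r)) \<partial>rule_pmf G i a) =
      (\<Sum>r\<in>rules G i a. ennreal (vec_power (x(f := 0)) (rule_rhs G r)) * pmf (rule_pmf G i a) r)"
    using finite_rules[OF a] by (intro nn_integral_measure_pmf_support) (auto simp: set_rule_pmf[OF a])
  also have "\<dots> = (\<Sum>r\<in>rules G i a. ennreal (rule_prob G r * vec_power (x(f := 0)) (rule_rhs G r)))"
    using nonneg by (intro sum.cong) (auto simp: pmf_rule_pmf[OF a] ennreal_mult'' mult.commute)
  also have "\<dots> = ennreal (\<Sum>r\<in>rules G i a. rule_prob G r * vec_power (x(f := 0)) (rule_rhs G r))"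
    using nonneg rule_prob_pos[OF a] by (intro sum_ennreal) (auto intro!: mult_nonneg_nonneg intro: less_imp_le)
  also have "(\<Sum>r\<in>rules G i a. rule_prob G r * vec_power (x(f := 0)) (rule_rhs G r)) = action_poly G f i a x"
    unfolding action_poly_def using finite_rules[OF a]
    by (intro sum.mono_neutral_cong_right) (auto simp: vec_power_fun_upd_0)
  finally show ?thesis .
qed

lemma chosen_action:
  assumes "h \<in> histories G" "\<sigma> \<in> strategies G Player_N" "\<tau> \<in> strategies G Player_R"
    and "u \<in> set_pmf (\<sigma> h)" "w \<in> set_pmf (\<tau> h)" "ob \<in> population G h"
  shows "(if owner G (obj_type ob) = Player_N then u ob else w ob) \<in> actions G (obj_type ob)"
proof (cases "owner G (obj_type ob)")
  case Player_N
  have "u \<in> (\<Pi>\<^sub>E ob\<in>owned G Player_N (population G h). actions G (obj_type ob))"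
    using assms by (simp add: strategies_def subset_iff)
  moreover have "ob \<in> owned G Player_N (population G h)"
    using assms Player_N by (simp add: owned_def)
  ultimately show ?thesis
    using Player_N by auto
next
  case Player_R
  have "w \<in> (\<Pi>\<^sub>E ob\<in>owned G Player_R (population G h). actions G (obj_type ob))"
    using assms by (simp add: strategies_def subset_iff)
  moreover have "ob \<in> owned G Player_R (population G h)"
    using assms Player_R by (simp add: owned_def)
  ultimately show ?thesis
    using Player_R by auto
qed

lemma is_step_step_pmf:
  assumes h: "h \<in> histories G" and \<sigma>: "\<sigma> \<in> strategies G Player_N" and \<tau>: "\<tau> \<in> strategies G Player_R"
    and s: "s \<in> set_pmf (step_pmf G \<sigma> \<tau> h)"
  shows "is_step G (population G h) s"
proof -
  obtain u w where uw: "u \<in> set_pmf (\<sigma> h)" "w \<in> set_pmf (\<tau> h)"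
    and s: "s \<in> set_pmf (let act = (\<lambda>ob. if owner G (obj_type ob) = Player_N then u ob else w ob)
       in Pi_pmf (population G h) None
            (\<lambda>ob. map_pmf (\<lambda>r. Some (act ob, r)) (rule_pmf G (obj_type ob) (act ob))))"
    using s unfolding step_pmf_def set_bind_pmf by blast
  define act where "act ob = (if owner G (obj_type ob) = Player_N then u ob else w ob)" for ob
  have act: "act ob \<in> actions G (obj_type ob)" if "ob \<in> population G h" for ob
    unfolding act_def by (rule chosen_action[OF h \<sigma> \<tau> uw that])
  have s: "s \<in> PiE_dflt (population G h) None
      (\<lambda>ob. (\<lambda>r. Some (act ob, r)) ` set_pmf (rule_pmf G (obj_type ob) (act ob)))"
    using s unfolding Let_def act_def[symmetric] set_Pi_pmf[OF finite_population[OF h]]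
    by (simp add: comp_def)
  have in_pop: "\<exists>r\<in>rules G (obj_type ob) (act ob). s ob = Some (act ob, r)"
    if "ob \<in> population G h" for ob
    using s that set_rule_pmf[OF act[OF that]] by (fastforce simp: PiE_dflt_def)
  have out_pop: "s ob = None" if "ob \<notin> population G h" for ob
    using s that by (simp add: PiE_dflt_def)
  have dom: "dom s = population G h"
    using in_pop out_pop by fastforce
  moreover have "a \<in> actions G (obj_type ob) \<and> r \<in> rules G (obj_type ob) a"
    if "s ob = Some (a, r)" for ob a r
  proof -
    have "ob \<in> population G h"
      using that dom by blast
    with in_pop[OF this] act[OF this] that show ?thesis
      by auto
  qed
  ultimately show ?thesis
    by (simp add: is_step_def)
qed

lemma AE_play_history:
  assumes \<sigma>: "\<sigma> \<in> strategies G Player_N" and \<tau>: "\<tau> \<in> strategies G Player_R"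
  shows "AE \<omega> in play_measure G \<sigma> \<tau> \<mu>. \<omega> d \<in> histories G \<and> length (snd (\<omega> d)) = d"
proof (induction d)
  case 0
  define B where "B = {h. \<not> (h \<in> histories G \<and> length (snd h) = 0)}"
  have "(\<integral>\<^sup>+\<omega>. indicator B (\<omega> 0) \<partial>play_measure G \<sigma> \<tau> \<mu>) = (0 :: ennreal)"
    using nn_integral_play_0[where K = UNIV and \<phi> = "indicator B"]
    by (simp add: survival_def B_def histories.intros)
  then have "AE \<omega> in play_measure G \<sigma> \<tau> \<mu>. indicator B (\<omega> 0) = (0 :: ennreal)"
    by (subst (asm) nn_integral_0_iff_AE) (auto intro!: measurable_compose[OF measurable_play_coordinate])
  then show ?case
    by eventually_elim (auto simp: B_def indicator_def split: if_splits)
next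
  case (Suc d)
  define B where "B = {h. \<not> (h \<in> histories G \<and> length (snd h) = Suc d)}"
  have zero: "(\<integral>\<^sup>+s. indicator B (extend_history h s) \<partial>step_pmf G \<sigma> \<tau> h) = (0 :: ennreal)"
    if "h \<in> histories G \<and> length (snd h) = d" for h
  proof -
    have "AE s in step_pmf G \<sigma> \<tau> h. indicator B (extend_history h s) = (0 :: ennreal)"
      using that is_step_step_pmf[OF _ \<sigma> \<tau>]
      by (intro AE_pmfI) (auto simp: B_def extend_history_in_histories length_extend_history)
    then show ?thesis
      by (subst nn_integral_0_iff_AE) auto
  qed
  have "(\<integral>\<^sup>+\<omega>. indicator B (\<omega> (Suc d)) \<partial>play_measure G \<sigma> \<tau> \<mu>) =
      (\<integral>\<^sup>+\<omega>. (\<integral>\<^sup>+s. indicator B (extend_history (\<omega> d) s) \<partial>step_pmf G \<sigma> \<tau> (\<omega> d)) \<partial>play_measure G \<sigma> \<tau> \<mu>)"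
    using nn_integral_play_Suc[where K = UNIV and \<phi> = "indicator B"] by (simp add: survival_def)
  also have "\<dots> = (\<integral>\<^sup>+\<omega>. 0 \<partial>play_measure G \<sigma> \<tau> \<mu>)"
    by (rule nn_integral_cong_AE, rule AE_mp[OF Suc], rule AE_I2) (simp add: zero)
  finally have "(\<integral>\<^sup>+\<omega>. indicator B (\<omega> (Suc d)) \<partial>play_measure G \<sigma> \<tau> \<mu>) = (0 :: ennreal)"
    by simp
  then have "AE \<omega> in play_measure G \<sigma> \<tau> \<mu>. indicator B (\<omega> (Suc d)) = (0 :: ennreal)"
    by (subst (asm) nn_integral_0_iff_AE) (auto intro!: measurable_compose[OF measurable_play_coordinate])
  then show ?case
    by eventually_elim (auto simp: B_def indicator_def split: if_splits)
qed

lemma nn_integral_step_potential: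
  assumes h: "h \<in> histories G" and \<sigma>: "\<sigma> \<in> strategies G Player_N" and \<tau>: "\<tau> \<in> strategies G Player_R"
    and x: "\<And>i. i \<noteq> f \<Longrightarrow> 0 \<le> x i"
  shows "(\<integral>\<^sup>+s. indicator (target_free G f) (extend_history h s) * potential G f x (extend_history h s)
        \<partial>step_pmf G \<sigma> \<tau> h) =
    (\<integral>\<^sup>+u. (\<integral>\<^sup>+w. (\<Prod>ob\<in>population G h. ennreal (action_poly G f (obj_type ob)
        (if owner G (obj_type ob) = Player_N then u ob else w ob) x)) \<partial>\<tau> h) \<partial>\<sigma> h)"
proof -
  have fin: "finite (population G h)"
    using h by (rule finite_population)
  have y: "0 \<le> (x(f := 0)) i" for i
    using x by simp
  have "(\<integral>\<^sup>+s. indicator (target_free G f) (extend_history h s) * potential G f x (extend_history h s)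
        \<partial>step_pmf G \<sigma> \<tau> h) =
      (\<integral>\<^sup>+s. (\<Prod>ob\<in>population G h.
        ennreal (vec_power (x(f := 0)) (rule_rhs G (snd (the (s ob)))))) \<partial>step_pmf G \<sigma> \<tau> h)"
  proof (intro nn_integral_cong_AE AE_pmfI)
    fix s assume "s \<in> set_pmf (step_pmf G \<sigma> \<tau> h)"
    then have s: "is_step G (population G h) s"
      by (rule is_step_step_pmf[OF h \<sigma> \<tau>])
    then have dom: "dom s = population G h"
      by (simp add: is_step_def)
    have "finite (population G (extend_history h s))"
      by (intro finite_population extend_history_in_histories h s)
    then have "indicator (target_free G f) (extend_history h s) * potential G f x (extend_history h s) =
        potential G f x (extend_history h s)"
      using potential_not_target_free[of G "extend_history h s" f x] by (simp add: indicator_def)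
    also have "\<dots> = ennreal (\<Prod>ob\<in>next_population G s. (x(f := 0)) (obj_type ob))"
      unfolding potential_def population_extend_history by (intro prod_ennreal y)
    also have "\<dots> = ennreal (\<Prod>ob\<in>population G h. vec_power (x(f := 0)) (rule_rhs G (snd (the (s ob)))))"
      using fin by (subst prod_next_population) (simp_all add: dom)
    also have "\<dots> = (\<Prod>ob\<in>population G h. ennreal (vec_power (x(f := 0)) (rule_rhs G (snd (the (s ob))))))"
      by (intro prod_ennreal[symmetric] vec_power_nonneg y)
    finally show "indicator (target_free G f) (extend_history h s) * potential G f x (extend_history h s) =
        (\<Prod>ob\<in>population G h. ennreal (vec_power (x(f := 0)) (rule_rhs G (snd (the (s ob))))))" .
  qed
  also have "\<dots> = (\<integral>\<^sup>+u. (\<integral>\<^sup>+w. (\<Prod>ob\<in>population G h. ennreal (action_poly G f (obj_type ob)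
        (if owner G (obj_type ob) = Player_N then u ob else w ob) x)) \<partial>\<tau> h) \<partial>\<sigma> h)"
    unfolding step_pmf_def nn_integral_bind_pmf Let_def
  proof (intro nn_integral_cong_AE AE_pmfI)
    fix u w assume uw: "u \<in> set_pmf (\<sigma> h)" "w \<in> set_pmf (\<tau> h)"
    let ?act = "\<lambda>ob. if owner G (obj_type ob) = Player_N then u ob else w ob"
    show "(\<integral>\<^sup>+s. (\<Prod>ob\<in>population G h. ennreal (vec_power (x(f := 0)) (rule_rhs G (snd (the (s ob))))))
        \<partial>Pi_pmf (population G h) None
          (\<lambda>ob. map_pmf (\<lambda>r. Some (?act ob, r)) (rule_pmf G (obj_type ob) (?act ob)))) =
      (\<Prod>ob\<in>population G h. ennreal (action_poly G f (obj_type ob) (?act ob) x))"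
      (is "?L = ?R")
    proof -
      have "?L = (\<Prod>ob\<in>population G h. \<integral>\<^sup>+v. ennreal (vec_power (x(f := 0)) (rule_rhs G (snd (the v))))
          \<partial>map_pmf (\<lambda>r. Some (?act ob, r)) (rule_pmf G (obj_type ob) (?act ob)))"
        by (rule nn_integral_prod_Pi_pmf[OF fin])
      also have "\<dots> = ?R"
      proof (rule prod.cong[OF refl])
        fix ob assume "ob \<in> population G h"
        then have "?act ob \<in> actions G (obj_type ob)"
          by (rule chosen_action[OF h \<sigma> \<tau> uw])
        from nn_integral_rule_pmf[OF this x]
        show "(\<integral>\<^sup>+v. ennreal (vec_power (x(f := 0)) (rule_rhs G (snd (the v))))
            \<partial>map_pmf (\<lambda>r. Some (?act ob, r)) (rule_pmf G (obj_type ob) (?act ob))) =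
          ennreal (action_poly G f (obj_type ob) (?act ob) x)"
          by (simp only: nn_integral_map_pmf option.sel snd_conv)
      qed
      finally show ?thesis .
    qed
  qed
  finally show ?thesis .
qed

lemma potential_le_step:
  assumes h: "h \<in> histories G" "h \<in> target_free G f"
    and \<sigma>: "\<sigma> \<in> strategies G Player_N" and \<tau>: "\<tau> \<in> strategies G Player_R"
    and x: "\<And>i. i \<noteq> f \<Longrightarrow> 0 \<le> x i" and y: "\<And>i. i \<noteq> f \<Longrightarrow> 0 \<le> y i"
    and le: "\<And>u w ob. u \<in> set_pmf (\<sigma> h) \<Longrightarrow> w \<in> set_pmf (\<tau> h) \<Longrightarrow> ob \<in> population G h \<Longrightarrow>
      obj_type ob \<noteq> f \<Longrightarrow> y (obj_type ob) \<le> action_poly G f (obj_type ob)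
        (if owner G (obj_type ob) = Player_N then u ob else w ob) x"
  shows "potential G f y h \<le>
    (\<integral>\<^sup>+s. indicator (target_free G f) (extend_history h s) * potential G f x (extend_history h s)
        \<partial>step_pmf G \<sigma> \<tau> h)"
proof -
  have ne: "obj_type ob \<noteq> f" if "ob \<in> population G h" for ob
    by (rule obj_type_target_free[OF finite_population[OF h(1)] h(2) that])
  have "potential G f y h = (\<integral>\<^sup>+u. (\<integral>\<^sup>+w. potential G f y h \<partial>\<tau> h) \<partial>\<sigma> h)"
    by simp
  also have "\<dots> \<le> (\<integral>\<^sup>+u. (\<integral>\<^sup>+w. (\<Prod>ob\<in>population G h. ennreal (action_poly G f (obj_type ob)
        (if owner G (obj_type ob) = Player_N then u ob else w ob) x)) \<partial>\<tau> h) \<partial>\<sigma> h)"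
    unfolding potential_def
    using ne le y by (intro nn_integral_mono_AE AE_pmfI prod_ennreal_mono) simp
  finally show ?thesis
    by (simp add: nn_integral_step_potential[OF h(1) \<sigma> \<tau> x])
qed

lemma step_le_potential:
  assumes h: "h \<in> histories G" "h \<in> target_free G f"
    and \<sigma>: "\<sigma> \<in> strategies G Player_N" and \<tau>: "\<tau> \<in> strategies G Player_R"
    and x: "\<And>i. i \<noteq> f \<Longrightarrow> 0 \<le> x i"
    and le: "\<And>u w ob. u \<in> set_pmf (\<sigma> h) \<Longrightarrow> w \<in> set_pmf (\<tau> h) \<Longrightarrow> ob \<in> population G h \<Longrightarrow>
      obj_type ob \<noteq> f \<Longrightarrow> action_poly G f (obj_type ob)
        (if owner G (obj_type ob) = Player_N then u ob else w ob) x \<in> {0..y (obj_type ob)}"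
  shows "(\<integral>\<^sup>+s. indicator (target_free G f) (extend_history h s) * potential G f x (extend_history h s)
        \<partial>step_pmf G \<sigma> \<tau> h) \<le> potential G f y h"
proof -
  have ne: "obj_type ob \<noteq> f" if "ob \<in> population G h" for ob
    by (rule obj_type_target_free[OF finite_population[OF h(1)] h(2) that])
  have "(\<integral>\<^sup>+u. (\<integral>\<^sup>+w. (\<Prod>ob\<in>population G h. ennreal (action_poly G f (obj_type ob)
        (if owner G (obj_type ob) = Player_N then u ob else w ob) x)) \<partial>\<tau> h) \<partial>\<sigma> h) \<le>
      (\<integral>\<^sup>+u. (\<integral>\<^sup>+w. potential G f y h \<partial>\<tau> h) \<partial>\<sigma> h)"
    unfolding potential_def
    using ne le by (intro nn_integral_mono_AE AE_pmfI prod_ennreal_mono) simp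
  then show ?thesis
    by (simp add: nn_integral_step_potential[OF h(1) \<sigma> \<tau> x])
qed

lemma nn_integral_survival_mono:
  assumes \<sigma>: "\<sigma> \<in> strategies G Player_N" and \<tau>: "\<tau> \<in> strategies G Player_R"
    and le: "\<And>h. h \<in> histories G \<Longrightarrow> length (snd h) = d \<Longrightarrow> h \<in> K \<Longrightarrow> \<phi> h \<le> \<psi> h"
  shows "(\<integral>\<^sup>+\<omega>. indicator (survival K d) \<omega> * \<phi> (\<omega> d) \<partial>play_measure G \<sigma> \<tau> \<mu>) \<le>
    (\<integral>\<^sup>+\<omega>. indicator (survival K d) \<omega> * \<psi> (\<omega> d) \<partial>play_measure G \<sigma> \<tau> \<mu>)"
  by (rule nn_integral_mono_AE, rule AE_mp[OF AE_play_history[OF \<sigma> \<tau>, of d]], rule AE_I2)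
     (auto simp: survival_def indicator_def le)

lemma action_poly_mono:
  assumes a: "a \<in> actions G i" and le: "\<And>j. j \<noteq> f \<Longrightarrow> 0 \<le> x j \<and> x j \<le> y j"
  shows "action_poly G f i a x \<le> action_poly G f i a y"
  unfolding action_poly_def
proof (intro sum_mono mult_left_mono vec_power_mono)
  fix r j assume "r \<in> {r \<in> rules G i a. rule_rhs G r f = 0}" "rule_rhs G r j \<noteq> 0"
  then show "0 \<le> x j \<and> x j \<le> y j"
    using le[of j] by (cases "j = f") auto
qed (use rule_prob_pos[OF a] in \<open>auto intro: less_imp_le\<close>)

lemma action_poly_bounds:
  assumes a: "a \<in> actions G i" and x: "\<And>j. j \<noteq> f \<Longrightarrow> x j \<in> {0..1}"
  shows "action_poly G f i a x \<in> {0..1}"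
proof -
  have "0 \<le> rule_prob G r * vec_power x (rule_rhs G r)"
    if "r \<in> {r \<in> rules G i a. rule_rhs G r f = 0}" for r
  proof (intro mult_nonneg_nonneg vec_power_nonneg)
    show "0 \<le> rule_prob G r"
      using rule_prob_pos[OF a] that by (auto intro: less_imp_le)
    show "0 \<le> x j" if "rule_rhs G r j \<noteq> 0" for j
      using x[of j] that \<open>r \<in> _\<close> by (cases "j = f") auto
  qed
  then have "0 \<le> action_poly G f i a x"
    unfolding action_poly_def by (rule sum_nonneg)
  moreover have "action_poly G f i a x \<le> action_poly G f i a (\<lambda>_. 1)"
    using a x by (intro action_poly_mono) auto
  moreover have "action_poly G f i a (\<lambda>_. 1) \<le> (\<Sum>r\<in>rules G i a. rule_prob G r)"
    unfolding action_poly_def vec_power_def using finite_rules[OF a] rule_prob_pos[OF a]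
    by (auto intro!: sum_mono2 intro: less_imp_le)
  ultimately show ?thesis
    using sum_rule_prob[OF a] by simp
qed

lemma maxmin_op_attained:
  assumes "i \<noteq> f"
  shows "\<exists>a\<in>actions G i. action_poly G f i a x = maxmin_op G f x i"
proof -
  let ?A = "(\<lambda>a. action_poly G f i a x) ` actions G i"
  have "finite ?A" "?A \<noteq> {}"
    using finite_actions actions_nonempty by auto
  then have "Max ?A \<in> ?A" "Min ?A \<in> ?A"
    by (rule Max_in, rule Min_in)
  with assms have "maxmin_op G f x i \<in> ?A"
    by (cases "owner G i") (simp_all add: maxmin_op_def)
  then show ?thesis
    by auto
qed

lemma maxmin_op_ge:
  assumes "i \<noteq> f" "owner G i = Player_N" "a \<in> actions G i"
  shows "action_poly G f i a x \<le> maxmin_op G f x i"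
  using assms finite_actions[of i] by (simp add: maxmin_op_def)

lemma maxmin_op_le:
  assumes "i \<noteq> f" "owner G i = Player_R" "a \<in> actions G i"
  shows "maxmin_op G f x i \<le> action_poly G f i a x"
  using assms finite_actions[of i] by (simp add: maxmin_op_def)

lemma maxmin_op_bounds:
  assumes "i \<noteq> f" "\<And>j. j \<noteq> f \<Longrightarrow> x j \<in> {0..1}"
  shows "maxmin_op G f x i \<in> {0..1}"
proof -
  obtain a where a: "a \<in> actions G i" "action_poly G f i a x = maxmin_op G f x i"
    using maxmin_op_attained[OF assms(1)] by blast
  have "action_poly G f i a x \<in> {0..1}"
    using a(1) assms(2) by (rule action_poly_bounds)
  with a(2) show ?thesis
    by simp
qed

lemma maxmin_op_mono:
  assumes i: "i \<noteq> f" and le: "\<And>j. j \<noteq> f \<Longrightarrow> 0 \<le> x j \<and> x j \<le> y j"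
  shows "maxmin_op G f x i \<le> maxmin_op G f y i"
proof (cases "owner G i")
  case Player_N
  obtain a where a: "a \<in> actions G i" "action_poly G f i a x = maxmin_op G f x i"
    using maxmin_op_attained[OF i] by blast
  then show ?thesis
    using action_poly_mono[OF a(1), of x y] le maxmin_op_ge[OF i Player_N a(1), of y] by fastforce
next
  case Player_R
  obtain a where a: "a \<in> actions G i" "action_poly G f i a y = maxmin_op G f y i"
    using maxmin_op_attained[OF i] by blast
  then show ?thesis
    using action_poly_mono[OF a(1), of x y] le maxmin_op_le[OF i Player_R a(1), of x] by fastforce
qed

lemma tendsto_maxmin_op:
  assumes "i \<noteq> f" "\<And>j. j \<noteq> f \<Longrightarrow> ((\<lambda>k. X k j) \<longlongrightarrow> x j) F"
  shows "((\<lambda>k. maxmin_op G f (X k) i) \<longlongrightarrow> maxmin_op G f x i) F"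
proof -
  have "((\<lambda>k. action_poly G f i a (X k)) \<longlongrightarrow> action_poly G f i a x) F" for a
    by (rule tendsto_action_poly) (rule assms(2))
  then show ?thesis
    using assms(1) finite_actions[of i] actions_nonempty[of i]
    by (cases "owner G i") (simp_all add: maxmin_op_def tendsto_Max_image tendsto_Min_image)
qed

lemma optimal_choice:
  obtains c where "\<And>i. c i \<in> actions G i"
    and "\<And>i. i \<noteq> f \<Longrightarrow> action_poly G f i (c i) x = maxmin_op G f x i"
proof -
  have "\<exists>a. a \<in> actions G i \<and> (i \<noteq> f \<longrightarrow> action_poly G f i a x = maxmin_op G f x i)" for i
    using maxmin_op_attained[of i x] actions_nonempty[of i] by (cases "i = f") auto
  then have "\<exists>c. \<forall>i. c i \<in> actions G i \<and> (i \<noteq> f \<longrightarrow> action_poly G f i (c i) x = maxmin_op G f x i)"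
    by (intro choice allI)
  then show ?thesis
    using that by blast
qed

lemma Player_N_guarantee:
  assumes x: "\<And>i. i \<noteq> f \<Longrightarrow> x i \<in> {0..1}" and le: "\<And>i. i \<noteq> f \<Longrightarrow> x i \<le> maxmin_op G f x i"
  shows "\<exists>\<sigma>\<in>strategies G Player_N. \<forall>\<tau>\<in>strategies G Player_R. \<forall>\<mu>. \<mu> f = 0 \<longrightarrow>
    vec_power x \<mu> \<le> nonreach_prob G f \<sigma> \<tau> \<mu>"
proof -
  obtain c where c: "\<And>i. c i \<in> actions G i"
    and opt: "\<And>i. i \<noteq> f \<Longrightarrow> action_poly G f i (c i) x = maxmin_op G f x i"
    using optimal_choice[of x] by blast
  define \<sigma> where "\<sigma> = markov_strategy G Player_N (\<lambda>_. c)"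
  have \<sigma>: "\<sigma> \<in> strategies G Player_N"
    unfolding \<sigma>_def by (rule markov_strategy_in_strategies) (rule c)
  have "vec_power x \<mu> \<le> nonreach_prob G f \<sigma> \<tau> \<mu>"
    if \<tau>: "\<tau> \<in> strategies G Player_R" and \<mu>: "\<mu> f = 0" for \<tau> \<mu>
  proof (rule nonreach_prob_ge)
    fix d
    let ?K = "target_free G f"
    let ?I = "\<lambda>d. \<integral>\<^sup>+\<omega>. indicator (survival ?K d) \<omega> * potential G f x (\<omega> d) \<partial>play_measure G \<sigma> \<tau> \<mu>"
    have step: "potential G f x h \<le>
        (\<integral>\<^sup>+s. indicator ?K (extend_history h s) * potential G f x (extend_history h s) \<partial>step_pmf G \<sigma> \<tau> h)"
      if h: "h \<in> histories G" "h \<in> ?K" for h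
    proof (rule potential_le_step[OF h \<sigma> \<tau>])
      fix u w ob
      assume uw: "u \<in> set_pmf (\<sigma> h)" "w \<in> set_pmf (\<tau> h)" and ob: "ob \<in> population G h"
        and ne: "obj_type ob \<noteq> f"
      let ?a = "if owner G (obj_type ob) = Player_N then u ob else w ob"
      have a: "?a \<in> actions G (obj_type ob)"
        by (rule chosen_action[OF h(1) \<sigma> \<tau> uw ob])
      have "maxmin_op G f x (obj_type ob) \<le> action_poly G f (obj_type ob) ?a x"
      proof (cases "owner G (obj_type ob)")
        case Player_N
        then have "?a = c (obj_type ob)"
          using uw(1) ob by (simp add: \<sigma>_def markov_strategy_def owned_def)
        then show ?thesis
          using opt[OF ne] by simp
      next
        case Player_R
        then show ?thesis
          using maxmin_op_le[OF ne Player_R a] by simp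
      qed
      then show "x (obj_type ob) \<le> action_poly G f (obj_type ob) ?a x"
        using le[OF ne] by linarith
    qed (use x in auto)
    have "(\<mu>, []) \<in> ?K"
      using \<mu> by (simp add: target_free_def population_def type_count_initial_population)
    then have "?I 0 = ennreal (vec_power x \<mu>)"
      using x \<mu> by (simp add: nn_integral_play_0 potential_initial)
    moreover have "?I d \<le> ?I (Suc d)" for d
      unfolding nn_integral_play_Suc by (rule nn_integral_survival_mono[OF \<sigma> \<tau>]) (rule step)
    then have "?I 0 \<le> ?I d"
      by (rule lift_Suc_mono_le) simp
    moreover have "?I d \<le> emeasure (play_measure G \<sigma> \<tau> \<mu>) (survival ?K d)"
      unfolding emeasure_survival
    proof (rule nn_integral_survival_mono[OF \<sigma> \<tau>])
      fix h
      have "potential G f x h \<le> (\<Prod>ob\<in>population G h. ennreal 1)"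
        unfolding potential_def using x by (intro prod_ennreal_mono) simp
      then show "potential G f x h \<le> 1"
        by simp
    qed
    ultimately show "ennreal (vec_power x \<mu>) \<le> emeasure (play_measure G \<sigma> \<tau> \<mu>) (survival ?K d)"
      by simp
  qed
  with \<sigma> show ?thesis
    by blast
qed

lemma value_iteration_bounds: "i \<noteq> f \<Longrightarrow> value_iteration G f k i \<in> {0..1}"
proof (induction k arbitrary: i)
  case 0
  then show ?case
    by (simp add: value_iteration_0)
next
  case (Suc k)
  then show ?case
    unfolding value_iteration_Suc by (intro maxmin_op_bounds)
qed

lemma Player_R_guarantee:
  "\<exists>\<tau>\<in>strategies G Player_R. \<forall>\<sigma>\<in>strategies G Player_N. \<forall>\<mu>. \<mu> f = 0 \<longrightarrow>
    nonreach_prob G f \<sigma> \<tau> \<mu> \<le> vec_power (value_iteration G f k) \<mu>"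
proof -
  let ?X = "value_iteration G f"
  have "\<exists>c. \<forall>i. c i \<in> actions G i \<and>
      (i \<noteq> f \<longrightarrow> action_poly G f i (c i) (?X n) = ?X (Suc n) i)" for n
    unfolding value_iteration_Suc by (rule optimal_choice[of "?X n"]) blast
  then obtain c where c: "\<And>n i. c n i \<in> actions G i"
    and opt: "\<And>n i. i \<noteq> f \<Longrightarrow> action_poly G f i (c n i) (?X n) = ?X (Suc n) i"
    using choice[of "\<lambda>n c. \<forall>i. c i \<in> actions G i \<and>
      (i \<noteq> f \<longrightarrow> action_poly G f i (c i) (?X n) = ?X (Suc n) i)"] by blast
  define \<tau> where "\<tau> = markov_strategy G Player_R (\<lambda>d. c (k - Suc d))"
  have \<tau>: "\<tau> \<in> strategies G Player_R"
    unfolding \<tau>_def by (rule markov_strategy_in_strategies) (rule c)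
  have X: "0 \<le> ?X n i" "?X n i \<in> {0..1}" if "i \<noteq> f" for n i
    using value_iteration_bounds[OF that] by auto
  have "nonreach_prob G f \<sigma> \<tau> \<mu> \<le> vec_power (?X k) \<mu>"
    if \<sigma>: "\<sigma> \<in> strategies G Player_N" and \<mu>: "\<mu> f = 0" for \<sigma> \<mu>
  proof (rule nonreach_prob_le)
    let ?K = "target_free G f"
    let ?I = "\<lambda>d. \<integral>\<^sup>+\<omega>. indicator (survival ?K d) \<omega> * potential G f (?X (k - d)) (\<omega> d)
      \<partial>play_measure G \<sigma> \<tau> \<mu>"
    have step: "(\<integral>\<^sup>+s. indicator ?K (extend_history h s) * potential G f (?X (k - Suc d)) (extend_history h s)
          \<partial>step_pmf G \<sigma> \<tau> h) \<le> potential G f (?X (k - d)) h"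
      if h: "h \<in> histories G" "h \<in> ?K" and d: "length (snd h) = d" "d < k" for h d
    proof (rule step_le_potential[OF h \<sigma> \<tau>])
      have k: "k - d = Suc (k - Suc d)"
        using d by simp
      fix u w ob
      assume uw: "u \<in> set_pmf (\<sigma> h)" "w \<in> set_pmf (\<tau> h)" and ob: "ob \<in> population G h"
        and ne: "obj_type ob \<noteq> f"
      let ?a = "if owner G (obj_type ob) = Player_N then u ob else w ob"
      have a: "?a \<in> actions G (obj_type ob)"
        by (rule chosen_action[OF h(1) \<sigma> \<tau> uw ob])
      have "action_poly G f (obj_type ob) ?a (?X (k - Suc d)) \<le> ?X (k - d) (obj_type ob)"
      proof (cases "owner G (obj_type ob)")
        case Player_N
        then show ?thesis
          using maxmin_op_ge[OF ne Player_N a] by (simp add: k value_iteration_Suc)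
      next
        case Player_R
        then have "?a = c (k - Suc d) (obj_type ob)"
          using uw(2) ob d by (simp add: \<tau>_def markov_strategy_def owned_def)
        then show ?thesis
          using opt[OF ne] by (simp add: k)
      qed
      moreover have "0 \<le> action_poly G f (obj_type ob) ?a (?X (k - Suc d))"
        using action_poly_bounds[OF a, of "?X (k - Suc d)"] X(2) by simp
      ultimately show "action_poly G f (obj_type ob) ?a (?X (k - Suc d)) \<in> {0..?X (k - d) (obj_type ob)}"
        by simp
    qed (rule X)
    have "(\<mu>, []) \<in> ?K"
      using \<mu> by (simp add: target_free_def population_def type_count_initial_population)
    then have I0: "?I 0 = ennreal (vec_power (?X k) \<mu>)"
      using X \<mu> by (simp add: nn_integral_play_0 potential_initial)
    have "?I d \<le> ?I 0" if "d \<le> k" for d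
      using that
    proof (induction d)
      case (Suc d)
      have "?I (Suc d) \<le> ?I d"
        unfolding nn_integral_play_Suc
        by (rule nn_integral_survival_mono[OF \<sigma> \<tau>]) (use Suc in \<open>auto intro!: step\<close>)
      also have "?I d \<le> ?I 0"
        using Suc by simp
      finally show ?case .
    qed simp
    from this[of k] have "?I k \<le> ennreal (vec_power (?X k) \<mu>)"
      unfolding I0 by simp
    moreover have "emeasure (play_measure G \<sigma> \<tau> \<mu>) (survival ?K k) \<le> ?I k"
      unfolding emeasure_survival
    proof (rule nn_integral_survival_mono[OF \<sigma> \<tau>])
      fix h assume h: "h \<in> histories G" "h \<in> ?K"
      have "potential G f (?X 0) h = (\<Prod>ob\<in>population G h. 1)"
        unfolding potential_def
      proof (rule prod.cong[OF refl])
        fix ob assume "ob \<in> population G h"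
        then have "obj_type ob \<noteq> f"
          by (rule obj_type_target_free[OF finite_population[OF h(1)] h(2)])
        then show "ennreal (((?X 0)(f := 0)) (obj_type ob)) = 1"
          by (simp add: value_iteration_0)
      qed
      then show "1 \<le> potential G f (?X (k - k)) h"
        by simp
    qed
    ultimately show "emeasure (play_measure G \<sigma> \<tau> \<mu>) (survival ?K k) \<le> ennreal (vec_power (?X k) \<mu>)"
      by (rule order_trans[rotated])
    show "0 \<le> vec_power (?X k) \<mu>"
    proof (rule vec_power_nonneg)
      show "0 \<le> ?X k i" if "\<mu> i \<noteq> 0" for i
        using that \<mu> by (cases "i = f") (auto intro: X)
    qed
  qed
  with \<tau> show ?thesis
    by blast
qed

lemma value_iteration_decreasing:
  assumes "i \<noteq> f"
  shows "value_iteration G f (Suc k) i \<le> value_iteration G f k i"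
  using assms
proof (induction k arbitrary: i)
  case 0
  then show ?case
    using value_iteration_bounds[OF 0, of 1] by (simp add: value_iteration_0)
next
  case (Suc k)
  have "maxmin_op G f (value_iteration G f (Suc k)) i \<le> maxmin_op G f (value_iteration G f k) i"
    by (rule maxmin_op_mono[OF Suc.prems]) (use Suc.IH value_iteration_bounds in simp)
  then show ?case
    by (simp only: value_iteration_Suc)
qed

lemma value_iteration_convergent:
  obtains g where "g \<in> (- {f}) \<rightarrow>\<^sub>E {0..1}" "g = maxmin_op G f g"
    "\<And>i. i \<noteq> f \<Longrightarrow> (\<lambda>k. value_iteration G f k i) \<longlonglongrightarrow> g i"
proof -
  let ?X = "value_iteration G f"
  have conv: "convergent (\<lambda>k. ?X k i)" if "i \<noteq> f" for i
  proof -
    have "decseq (\<lambda>k. ?X k i)"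
      using value_iteration_decreasing[OF that] by (simp add: decseq_Suc_iff)
    then show ?thesis
      using value_iteration_bounds[OF that] decseq_convergent[of "\<lambda>k. ?X k i" 0]
      unfolding convergent_def atLeastAtMost_iff by blast
  qed
  define g where "g = (\<lambda>i\<in>- {f}. lim (\<lambda>k. ?X k i))"
  have lim: "(\<lambda>k. ?X k i) \<longlonglongrightarrow> g i" if "i \<noteq> f" for i
    using conv[OF that] that by (simp add: g_def convergent_LIMSEQ_iff)
  have "g i \<in> {0..1}" if "i \<noteq> f" for i
    using value_iteration_bounds[OF that] LIMSEQ_le_const[OF lim[OF that], of 0]
      LIMSEQ_le_const2[OF lim[OF that], of 1] by auto
  then have 1: "g \<in> (- {f}) \<rightarrow>\<^sub>E {0..1}"
    by (auto simp: g_def)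
  have 2: "g = maxmin_op G f g"
  proof
    fix i
    show "g i = maxmin_op G f g i"
    proof (cases "i = f")
      case True
      then show ?thesis
        by (simp add: g_def maxmin_op_def)
    next
      case False
      have "(\<lambda>k. ?X (Suc k) i) \<longlonglongrightarrow> maxmin_op G f g i"
        unfolding value_iteration_Suc by (intro tendsto_maxmin_op False lim)
      moreover have "(\<lambda>k. ?X (Suc k) i) \<longlonglongrightarrow> g i"
        using lim[OF False] by (rule LIMSEQ_Suc)
      ultimately show ?thesis
        by (rule LIMSEQ_unique[symmetric])
    qed
  qed
  show ?thesis
    using 1 2 lim by (rule that)
qed

lemma fixed_point_le_value_iteration:
  assumes g: "g' \<in> (- {f}) \<rightarrow>\<^sub>E {0..1}" "g' = maxmin_op G f g'" and "i \<noteq> f"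
  shows "g' i \<le> value_iteration G f k i"
  using \<open>i \<noteq> f\<close>
proof (induction k arbitrary: i)
  case 0
  with g(1) show ?case
    by (auto simp: value_iteration_0 PiE_iff)
next
  case (Suc k)
  have "maxmin_op G f g' i \<le> maxmin_op G f (value_iteration G f k) i"
    using Suc g(1) by (intro maxmin_op_mono) (auto simp: PiE_iff)
  with g(2) show ?case
    by (simp add: value_iteration_Suc)
qed

lemma strategies_nonempty: "strategies G p \<noteq> {}"
proof -
  have "markov_strategy G p (\<lambda>_ i. SOME a. a \<in> actions G i) \<in> strategies G p"
    by (rule markov_strategy_in_strategies) (simp add: some_in_eq actions_nonempty)
  then show ?thesis
    by blast
qed

end

subsection \<open>Determinacy\<close>

lemma vec_power_single_object: "vec_power x (single_object i) = x i"
proof -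
  have "vec_power x (single_object i) = (\<Prod>j\<in>UNIV. if j = i then x j else 1)"
    unfolding vec_power_def single_object_def by (intro prod.cong) auto
  then show ?thesis
    by simp
qed

lemma SUP_INF_eq_INF_SUP:
  fixes F :: "'s \<Rightarrow> 'u \<Rightarrow> real"
  assumes ne: "A \<noteq> {}" "B \<noteq> {}" and bounds: "\<And>a b. F a b \<in> {0..1}"
    and low: "a\<^sub>0 \<in> A" "\<And>b. b \<in> B \<Longrightarrow> v \<le> F a\<^sub>0 b"
    and up: "\<And>k. b k \<in> B" "\<And>k a. a \<in> A \<Longrightarrow> F a (b k) \<le> w k" and lim: "w \<longlonglongrightarrow> v"
  shows "(SUP a\<in>A. INF b\<in>B. F a b) = v" and "(INF b\<in>B. SUP a\<in>A. F a b) = v"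
proof -
  have F: "0 \<le> F a b" "F a b \<le> 1" for a b
    using bounds[of a b] by simp_all
  have bdd_below: "bdd_below (F a ` B)" for a
    by (rule bdd_belowI2[of _ 0]) (rule F)
  have bdd_above: "bdd_above ((\<lambda>a. F a b) ` A)" for b
    by (rule bdd_aboveI2[of _ _ 1]) (rule F)
  have bdd_INF: "bdd_above ((\<lambda>a. INF b\<in>B. F a b) ` A)"
  proof (rule bdd_aboveI2)
    fix a
    have "(INF b\<in>B. F a b) \<le> F a (b 0)"
      by (rule cINF_lower[OF bdd_below up(1)])
    also have "\<dots> \<le> 1"
      by (rule F)
    finally show "(INF b\<in>B. F a b) \<le> 1" .
  qed
  have bdd_SUP: "bdd_below ((\<lambda>b. SUP a\<in>A. F a b) ` B)"
  proof (rule bdd_belowI2)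
    fix b
    have "0 \<le> F a\<^sub>0 b"
      by (rule F)
    also have "\<dots> \<le> (SUP a\<in>A. F a b)"
      by (rule cSUP_upper[OF low(1) bdd_above])
    finally show "0 \<le> (SUP a\<in>A. F a b)" .
  qed
  have "v \<le> (INF b\<in>B. F a\<^sub>0 b)"
    by (rule cINF_greatest[OF ne(2) low(2)])
  also have "\<dots> \<le> (SUP a\<in>A. INF b\<in>B. F a b)"
    by (rule cSUP_upper[OF low(1) bdd_INF])
  finally have 1: "v \<le> (SUP a\<in>A. INF b\<in>B. F a b)" .
  have 2: "(SUP a\<in>A. INF b\<in>B. F a b) \<le> (INF b\<in>B. SUP a\<in>A. F a b)"
  proof (rule cSUP_least[OF ne(1)], rule cINF_greatest[OF ne(2)])
    fix a b assume "a \<in> A" "b \<in> B"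
    have "(INF b\<in>B. F a b) \<le> F a b"
      by (rule cINF_lower[OF bdd_below \<open>b \<in> B\<close>])
    also have "\<dots> \<le> (SUP a\<in>A. F a b)"
      by (rule cSUP_upper[OF \<open>a \<in> A\<close> bdd_above])
    finally show "(INF b\<in>B. F a b) \<le> (SUP a\<in>A. F a b)" .
  qed
  have "(INF b\<in>B. SUP a\<in>A. F a b) \<le> w k" for k
  proof -
    have "(INF b\<in>B. SUP a\<in>A. F a b) \<le> (SUP a\<in>A. F a (b k))"
      by (rule cINF_lower[OF bdd_SUP up(1)])
    also have "\<dots> \<le> w k"
      by (rule cSUP_least[OF ne(1) up(2)])
    finally show ?thesis .
  qed
  then have 3: "(INF b\<in>B. SUP a\<in>A. F a b) \<le> v"
    by (intro LIMSEQ_le_const[OF lim]) auto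
  from 1 2 3 show "(SUP a\<in>A. INF b\<in>B. F a b) = v" "(INF b\<in>B. SUP a\<in>A. F a b) = v"
    by linarith+
qed

theorem theorem3p1:
  fixes G :: "('t::finite, 'a, 'r) bssg" and f :: 't
  assumes "is_bssg G"
  shows "nonreach_vector G f \<in> (- {f}) \<rightarrow>\<^sub>E {0..1} \<and>
    nonreach_vector G f = maxmin_op G f (nonreach_vector G f) \<and>
    (\<forall>g' \<in> (- {f}) \<rightarrow>\<^sub>E {0..1}. g' = maxmin_op G f g' \<longrightarrow>
       (\<forall>i\<in>- {f}. g' i \<le> nonreach_vector G f i)) \<and>
    (\<forall>\<mu> :: 't \<Rightarrow> nat. \<mu> f = 0 \<longrightarrow>
       nonreach_value G f \<mu> = vec_power (nonreach_vector G f) \<mu> \<and>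
       nonreach_value G f \<mu> =
         (SUP \<sigma>\<in>strategies G Player_N. INF \<tau>\<in>strategies G Player_R. nonreach_prob G f \<sigma> \<tau> \<mu>) \<and>
       (SUP \<sigma>\<in>strategies G Player_N. INF \<tau>\<in>strategies G Player_R. nonreach_prob G f \<sigma> \<tau> \<mu>) =
         (INF \<tau>\<in>strategies G Player_R. SUP \<sigma>\<in>strategies G Player_N. nonreach_prob G f \<sigma> \<tau> \<mu>))"
proof -
  note bssg = assms
  obtain g where g: "g \<in> (- {f}) \<rightarrow>\<^sub>E {0..1}" "g = maxmin_op G f g"
    and lim: "\<And>i. i \<noteq> f \<Longrightarrow> (\<lambda>k. value_iteration G f k i) \<longlonglongrightarrow> g i"
    using value_iteration_convergent[OF bssg, of f] by blast
  have g_bounds: "g i \<in> {0..1}" if "i \<noteq> f" for i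
    using g(1) that by (auto simp: PiE_iff)
  have g_le: "g i \<le> maxmin_op G f g i" for i
    using g(2) by simp
  obtain \<sigma>\<^sub>0 where \<sigma>\<^sub>0: "\<sigma>\<^sub>0 \<in> strategies G Player_N"
    and low: "\<And>\<tau> \<mu>. \<tau> \<in> strategies G Player_R \<Longrightarrow> \<mu> f = 0 \<Longrightarrow> vec_power g \<mu> \<le> nonreach_prob G f \<sigma>\<^sub>0 \<tau> \<mu>"
    using Player_N_guarantee[OF bssg, of f g] g_bounds g_le by blast
  have "\<forall>k. \<exists>\<tau>. \<tau> \<in> strategies G Player_R \<and> (\<forall>\<sigma>\<in>strategies G Player_N. \<forall>\<mu>. \<mu> f = 0 \<longrightarrow>
      nonreach_prob G f \<sigma> \<tau> \<mu> \<le> vec_power (value_iteration G f k) \<mu>)"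
    using Player_R_guarantee[OF bssg, of f] unfolding Bex_def by (rule allI)
  from choice[OF this] obtain \<tau>' where \<tau>': "\<And>k. \<tau>' k \<in> strategies G Player_R"
    and up: "\<And>k \<sigma> \<mu>. \<sigma> \<in> strategies G Player_N \<Longrightarrow> \<mu> f = 0 \<Longrightarrow>
      nonreach_prob G f \<sigma> (\<tau>' k) \<mu> \<le> vec_power (value_iteration G f k) \<mu>"
    by blast
  have minimax: "(SUP \<sigma>\<in>strategies G Player_N. INF \<tau>\<in>strategies G Player_R. nonreach_prob G f \<sigma> \<tau> \<mu>) = vec_power g \<mu>"
    "(INF \<tau>\<in>strategies G Player_R. SUP \<sigma>\<in>strategies G Player_N. nonreach_prob G f \<sigma> \<tau> \<mu>) = vec_power g \<mu>"
    if \<mu>: "\<mu> f = 0" for \<mu>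
  proof -
    have "(\<lambda>k. vec_power (value_iteration G f k) \<mu>) \<longlonglongrightarrow> vec_power g \<mu>"
      using \<mu> by (intro tendsto_vec_power lim) auto
    from SUP_INF_eq_INF_SUP[where F = "\<lambda>\<sigma> \<tau>. nonreach_prob G f \<sigma> \<tau> \<mu>",
        OF strategies_nonempty[OF bssg] strategies_nonempty[OF bssg] nonreach_prob_bounds
        \<sigma>\<^sub>0 low[where \<mu> = \<mu>, OF _ \<mu>] \<tau>' up[where \<mu> = \<mu>, OF _ \<mu>] this]
    show "(SUP \<sigma>\<in>strategies G Player_N. INF \<tau>\<in>strategies G Player_R. nonreach_prob G f \<sigma> \<tau> \<mu>) = vec_power g \<mu>"
      "(INF \<tau>\<in>strategies G Player_R. SUP \<sigma>\<in>strategies G Player_N. nonreach_prob G f \<sigma> \<tau> \<mu>) = vec_power g \<mu>"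
      by blast+
  qed
  have nonreach_value: "nonreach_value G f \<mu> = vec_power g \<mu>" if "\<mu> f = 0" for \<mu>
    using minimax(1)[of \<mu>] that by (simp add: nonreach_value_def)
  have vector: "nonreach_vector G f = g"
  proof
    fix i
    show "nonreach_vector G f i = g i"
    proof (cases "i = f")
      case True
      then show ?thesis
        using g(1) by (simp add: nonreach_vector_def PiE_iff extensional_def)
    next
      case False
      then have "single_object i f = 0"
        by (simp add: single_object_def)
      with False show ?thesis
        by (simp add: nonreach_vector_def nonreach_value vec_power_single_object)
    qed
  qed
  have greatest: "g' i \<le> g i" if "g' \<in> (- {f}) \<rightarrow>\<^sub>E {0..1}" "g' = maxmin_op G f g'" "i \<noteq> f" for g' i
    using fixed_point_le_value_iteration[OF bssg that] by (intro LIMSEQ_le_const[OF lim[OF that(3)]]) auto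
  show ?thesis
    unfolding vector
  proof (intro conjI ballI allI impI)
    fix g' i assume "g' \<in> (- {f}) \<rightarrow>\<^sub>E {0..1}" "g' = maxmin_op G f g'" "i \<in> - {f}"
    then show "g' i \<le> g i"
      by (intro greatest) simp_all
  qed (use g in \<open>simp_all only: nonreach_value minimax\<close>)
qed

end
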